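(* Let $G$ be a finite connected graph. Then for every $(g,\rho)\in\mathcal{A}_+(G)$, $$\overline{\lambda_1}(g,\rho)>\frac{L(g)}{\operatorname{diam}(G,g)},\qquad\text{where } \overline{\lambda_1}(g,\rho):=\lambda_1(g,\rho)\,L(g)\int_{(G,g)}\rho\,dx_g$$ and $\operatorname{diam}(G,g)$ is the diameter of $(G,g)$.
   Context: $G=(V,E)$ is a finite connected discrete graph (loops and multiple edges allowed) with at least one edge. A metric on $G$ is a vector $g=(g_e)_{e\in E}\in\mathbb{R}_+^{|E|}$ of positive numbers; the edge $e$ has length $\ell_e=\sqrt{g_e}$ and is identified with $[0,\ell_e]$, making $(G,g)$ a compact metric (quantum) graph of total length $L(g)=\sum_e\ell_e$. $(G,g)$ carries the shortest-path distance between arbitrary points (including interior points of edges), and the diameter is taken with respect to it. $dx_g$ is the arclength measure on $(G,g)$ and $\Delta_gf=-f''$ with derivatives in arclength. $\mathcal{C}_+(G)$ is the set of densities: functions $\rho$, positive and smooth on each closed edge (smooth up to the endpoints; no continuity across vertices required). $\mathcal{A}_+(G)=\mathbb{R}_+^{|E|}\times\mathcal{C}_+(G)$. For $(g,\rho)\in\mathcal{A}_+(G)$, $0=\lambda_0(g,\rho)<\lambda_1(g,\rho)\le\lambda_2(g,\rho)\le\cdots$ are the eigenvalues (with multiplicity) of: $\Delta_gf=\lambda\rho f$ on edges; $f$ continuous on $(G,g)$; $\sum_{e\in E_v}f_e'(v)=0$ at every vertex $v$, where $E_v$ is the set of edges attached at $v$ (a loop contributes both its ends) and $f'_e(v)$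 is the derivative at $v$ pointing out of $v$ into $e$. *)

theory Defs
  imports
    "HOL-Analysis.Analysis"
    "HOL-Library.Function_Algebras"
    "Graph_Theory.Digraph_Component"
begin

text \<open>
  A discrete graph with loops and multiple edges is represented by an oriented multigraph; the
  orientation only serves to identify the edge \<open>e\<close> with \<open>{0..\<ell>\<^sub>e}\<close>, where \<open>0\<close> is the end at
  \<open>tail G e\<close> and \<open>\<ell>\<^sub>e\<close> the end at \<open>head G e\<close>. A function on the metric graph is a family of
  functions of the arclength parameter, one for each edge.
\<close>

definition edge_length :: "('e \<Rightarrow> real) \<Rightarrow> 'e \<Rightarrow> real" where
  "edge_length g e = sqrt (g e)"

definition total_length :: "('v, 'e) pre_digraph \<Rightarrow> ('e \<Rightarrow> real) \<Rightarrow> real" where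
  "total_length G g = (\<Sum>e\<in>arcs G. edge_length g e)"


subsection \<open>Shortest-path distance and diameter\<close>

text \<open>
  Points of \<open>(G, g)\<close> are pairs of an edge and an arclength parameter; edge ends at a common
  vertex are different pairs for the same point, so the distance below is a pseudometric on pairs
  that induces the shortest-path metric on the quotient. If \<open>G\<close> is connected and has an edge, then
  every vertex is such an edge end.
\<close>

definition graph_points :: "('v, 'e) pre_digraph \<Rightarrow> ('e \<Rightarrow> real) \<Rightarrow> ('e \<times> real) set" where
  "graph_points G g = {(e, t). e \<in> arcs G \<and> 0 \<le> t \<and> t \<le> edge_length g e}"

definition lies_at :: "('v, 'e) pre_digraph \<Rightarrow> ('e \<Rightarrow> real) \<Rightarrow> 'v \<Rightarrow> 'e \<times> real \<Rightarrow> bool" where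
  "lies_at G g v p \<longleftrightarrow> p \<in> graph_points G g \<and>
     (snd p = 0 \<and> tail G (fst p) = v \<or> snd p = edge_length g (fst p) \<and> head G (fst p) = v)"

inductive path_of_length ::
  "('v, 'e) pre_digraph \<Rightarrow> ('e \<Rightarrow> real) \<Rightarrow> 'e \<times> real \<Rightarrow> 'e \<times> real \<Rightarrow> real \<Rightarrow> bool"
  for G g where
  segment: "(e, s) \<in> graph_points G g \<Longrightarrow> (e, t) \<in> graph_points G g \<Longrightarrow>
    path_of_length G g (e, s) (e, t) \<bar>s - t\<bar>"
| vertex: "lies_at G g v p \<Longrightarrow> lies_at G g v q \<Longrightarrow> path_of_length G g p q 0"
| concat: "path_of_length G g p q a \<Longrightarrow> path_of_length G g q r b \<Longrightarrow>
    path_of_length G g p r (a + b)"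

definition graph_dist ::
  "('v, 'e) pre_digraph \<Rightarrow> ('e \<Rightarrow> real) \<Rightarrow> 'e \<times> real \<Rightarrow> 'e \<times> real \<Rightarrow> real" where
  "graph_dist G g p q = Inf {c. path_of_length G g p q c}"

definition graph_diam :: "('v, 'e) pre_digraph \<Rightarrow> ('e \<Rightarrow> real) \<Rightarrow> real" where
  "graph_diam G g = (SUP (p, q) \<in> graph_points G g \<times> graph_points G g. graph_dist G g p q)"


subsection \<open>Densities\<close>

definition smooth_upto_ends :: "real \<Rightarrow> (real \<Rightarrow> real) \<Rightarrow> bool" where
  "smooth_upto_ends l h \<longleftrightarrow> (\<exists>D. D 0 = h \<and>
     (\<forall>(n::nat). \<forall>x\<in>{0..l}. (D n has_real_derivative D (Suc n) x) (at x within {0..l})))"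

definition admissible_pairs ::
  "('v, 'e) pre_digraph \<Rightarrow> (('e \<Rightarrow> real) \<times> ('e \<Rightarrow> real \<Rightarrow> real)) set" where
  "admissible_pairs G = {(g, \<rho>). \<forall>e\<in>arcs G. g e > 0 \<and>
     smooth_upto_ends (edge_length g e) (\<rho> e) \<and> (\<forall>x\<in>{0..edge_length g e}. \<rho> e x > 0)}"

definition total_mass ::
  "('v, 'e) pre_digraph \<Rightarrow> ('e \<Rightarrow> real) \<Rightarrow> ('e \<Rightarrow> real \<Rightarrow> real) \<Rightarrow> real" where
  "total_mass G g \<rho> = (\<Sum>e\<in>arcs G. integral {0..edge_length g e} (\<rho> e))"


subsection \<open>Eigenvalues\<close>

definition continuous_on_graph ::
  "('v, 'e) pre_digraph \<Rightarrow> ('e \<Rightarrow> real) \<Rightarrow> ('e \<Rightarrow> real \<Rightarrow> real) \<Rightarrow> bool" where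
  "continuous_on_graph G g f \<longleftrightarrow>
     (\<forall>e\<in>arcs G. continuous_on {0..edge_length g e} (f e)) \<and>
     (\<forall>v p q. lies_at G g v p \<longrightarrow> lies_at G g v q \<longrightarrow>
        f (fst p) (snd p) = f (fst q) (snd q))"

text \<open>
  In the vertex condition the derivative pointing into the edge is \<open>f'\<close> at the tail end and \<open>-f'\<close>
  at the head end; a loop occurs in both sums.
\<close>

definition solves_eigenproblem ::
  "('v, 'e) pre_digraph \<Rightarrow> ('e \<Rightarrow> real) \<Rightarrow> ('e \<Rightarrow> real \<Rightarrow> real) \<Rightarrow> real
     \<Rightarrow> ('e \<Rightarrow> real \<Rightarrow> real) \<Rightarrow> bool" where
  "solves_eigenproblem G g \<rho> \<mu> f \<longleftrightarrow>
     continuous_on_graph G g f \<and>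
     (\<exists>f' f''.
       (\<forall>e\<in>arcs G. \<forall>x\<in>{0..edge_length g e}.
          (f e has_real_derivative f' e x) (at x within {0..edge_length g e}) \<and>
          (f' e has_real_derivative f'' e x) (at x within {0..edge_length g e}) \<and>
          - f'' e x = \<mu> * \<rho> e x * f e x) \<and>
       (\<forall>v\<in>verts G. (\<Sum>e | e \<in> arcs G \<and> tail G e = v. f' e 0) +
          (\<Sum>e | e \<in> arcs G \<and> head G e = v. - f' e (edge_length g e)) = 0))"

text \<open>Functions are normalised to vanish off the graph, where their values are meaningless.\<close>

definition eigenspace ::
  "('v, 'e) pre_digraph \<Rightarrow> ('e \<Rightarrow> real) \<Rightarrow> ('e \<Rightarrow> real \<Rightarrow> real) \<Rightarrow> real
     \<Rightarrow> ('e \<Rightarrow> real \<Rightarrow> real) set" where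
  "eigenspace G g \<rho> \<mu> = {f. solves_eigenproblem G g \<rho> \<mu> f \<and>
     (\<forall>e x. (e, x) \<notin> graph_points G g \<longrightarrow> f e x = 0)}"

definition fun_scale :: "real \<Rightarrow> ('e \<Rightarrow> real \<Rightarrow> real) \<Rightarrow> 'e \<Rightarrow> real \<Rightarrow> real" where
  "fun_scale c f = (\<lambda>e x. c * f e x)"

lemma vector_space_fun_scale: "vector_space fun_scale"
  by unfold_locales (auto simp: fun_scale_def algebra_simps fun_eq_iff)

definition multiplicity_of ::
  "('v, 'e) pre_digraph \<Rightarrow> ('e \<Rightarrow> real) \<Rightarrow> ('e \<Rightarrow> real \<Rightarrow> real) \<Rightarrow> real \<Rightarrow> nat" where
  "multiplicity_of G g \<rho> \<mu> = vector_space.dim fun_scale (eigenspace G g \<rho> \<mu>)"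

text \<open>
  \<open>lam 0 \<le> lam 1 \<le> \<dots>\<close> lists all eigenvalues, each repeated according to its multiplicity. A number
  that is not an eigenvalue has multiplicity \<open>0\<close> and hence does not occur.
\<close>

definition eigenvalue_sequence ::
  "('v, 'e) pre_digraph \<Rightarrow> ('e \<Rightarrow> real) \<Rightarrow> ('e \<Rightarrow> real \<Rightarrow> real) \<Rightarrow> (nat \<Rightarrow> real) \<Rightarrow> bool" where
  "eigenvalue_sequence G g \<rho> lam \<longleftrightarrow> mono lam \<and>
     (\<forall>\<mu>. finite {k. lam k = \<mu>} \<and> card {k. lam k = \<mu>} = multiplicity_of G g \<rho> \<mu>)"

definition normalized_eigenvalue ::
  "('v, 'e) pre_digraph \<Rightarrow> ('e \<Rightarrow> real) \<Rightarrow> ('e \<Rightarrow> real \<Rightarrow> real) \<Rightarrow> real \<Rightarrow> real" where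
  "normalized_eigenvalue G g \<rho> \<mu> = \<mu> * total_length G g * total_mass G g \<rho>"

end

theory Submission
  imports Defs
begin

text \<open>
  Let \<open>f\<close> be an eigenfunction for \<open>\<mu> = \<lambda>\<^sub>1 > 0\<close>, scaled so that \<open>M = max \<bar>f\<bar>\<close> is attained as
  \<open>f p = M\<close>. Summing \<open>f''\<close> over the edges, the vertex conditions give \<open>\<integral> \<rho> f = 0\<close>, so \<open>f q < 0\<close> for
  some \<open>q\<close>; integrating by parts, \<open>\<integral> (f')\<^sup>2 = \<mu> \<integral> \<rho> f\<^sup>2 \<le> \<mu> M\<^sup>2 \<integral> \<rho>\<close>. Along a path from \<open>p\<close> to \<open>q\<close>
  the Cauchy-Schwarz inequality gives \<open>M\<^sup>2 < (f p - f q)\<^sup>2 \<le> diam * \<integral> (f')\<^sup>2\<close>, and dividing by \<open>M\<^sup>2\<close>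
  yields \<open>1 < diam * \<mu> * \<integral> \<rho>\<close>. For \<open>\<mu> = 0\<close> the same estimate shows that \<open>f\<close> is constant, so \<open>0\<close> is a
  simple eigenvalue and \<open>\<lambda>\<^sub>1 > 0\<close>.

  A path may run through an edge repeatedly, so Cauchy-Schwarz is applied not to the path but to
  the set of points it covers: this set has measure at most the length of the path, and its image
  under \<open>f\<close> contains the interval between \<open>f q\<close> and \<open>f p\<close>.
\<close>

section \<open>Images of finite unions of intervals\<close>

lemma closed_segment_subset_image:
  fixes f :: "real \<Rightarrow> real"
  assumes "continuous_on (closed_segment s t) f"
  shows "closed_segment (f s) (f t) \<subseteq> f ` closed_segment s t"
proof -
  have "convex (f ` closed_segment s t)"
    using connected_continuous_image[OF assms] is_interval_connected_1 is_interval_convex_1 by blast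
  then show ?thesis
    by (simp add: closed_segment_subset)
qed

text \<open>The image is an interval \<open>{c..d}\<close> whose two ends are values of
  \<open>f\<close>. Hence \<open>d - c\<close> is the absolute value of an integral of
  \<open>f'\<close> between two points of \<open>{a..b}\<close>, in either order.\<close>

lemma measure_interval_image_le_integral:
  fixes f f' :: "real \<Rightarrow> real"
  assumes deriv: "\<And>x. x \<in> {a..b} \<Longrightarrow> (f has_real_derivative f' x) (at x within {a..b})"
    and cont: "continuous_on {a..b} f'" and "a \<le> b"
  shows "measure lebesgue (f ` {a..b}) \<le> integral {a..b} (\<lambda>x. \<bar>f' x\<bar>)"
proof -
  have cf: "continuous_on {a..b} f"
    using deriv DERIV_continuous continuous_on_eq_continuous_within by blast
  obtain c d where cd: "f ` {a..b} = {c..d}" "c \<le> d"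
    using continuous_image_closed_interval[OF \<open>a \<le> b\<close> cf] by blast
  have increment: "\<bar>f y - f x\<bar> \<le> integral {a..b} (\<lambda>x. \<bar>f' x\<bar>)"
    if "a \<le> x" "x \<le> y" "y \<le> b" for x y
  proof -
    have sub: "{x..y} \<subseteq> {a..b}" using that by auto
    have ints: "(\<lambda>x. \<bar>f' x\<bar>) integrable_on {x..y}" "(\<lambda>x. \<bar>f' x\<bar>) integrable_on {a..b}"
      "f' integrable_on {x..y}"
      using cont continuous_on_subset[OF cont sub]
      by (auto intro!: integrable_continuous_interval continuous_intros)
    have "(f' has_integral (f y - f x)) {x..y}"
      using that sub
      by (intro fundamental_theorem_of_calculus)
        (auto simp flip: has_real_derivative_iff_has_vector_derivative intro: DERIV_subset[OF deriv sub])
    then have "f y - f x = integral {x..y} f'"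
      by (simp add: integral_unique)
    then have "\<bar>f y - f x\<bar> \<le> integral {x..y} (\<lambda>x. \<bar>f' x\<bar>)"
      using integral_norm_bound_integral[OF ints(3,1)] by simp
    also have "\<dots> \<le> integral {a..b} (\<lambda>x. \<bar>f' x\<bar>)"
      using integral_subset_le[OF sub ints(1,2)] by simp
    finally show ?thesis .
  qed
  have "c \<in> f ` {a..b}" "d \<in> f ` {a..b}" using cd by auto
  then obtain x y where xy: "x \<in> {a..b}" "f x = c" "y \<in> {a..b}" "f y = d" by blast
  then have "d - c \<le> integral {a..b} (\<lambda>x. \<bar>f' x\<bar>)"
    using increment[of x y] increment[of y x] by (cases x y rule: linorder_le_cases) auto
  then show ?thesis using cd by simp
qed

lemma compact_if_division:
  fixes K :: "real set"
  assumes "d division_of K"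
  shows "compact K"
proof -
  have "compact i" if "i \<in> d" for i
    using division_ofD(4)[OF assms that] compact_cbox by metis
  then show ?thesis
    using division_ofD(1,6)[OF assms] compact_Union by metis
qed

text \<open>The images of the pieces of the division may overlap, so the measure is only
  subadditive, while the integral over \<open>K\<close> is additive over the pieces.\<close>

lemma measure_image_le_integral:
  fixes f f' :: "real \<Rightarrow> real"
  assumes deriv: "\<And>x. x \<in> {a..b} \<Longrightarrow> (f has_real_derivative f' x) (at x within {a..b})"
    and cont: "continuous_on {a..b} f'"
    and K: "K \<subseteq> {a..b}" "d division_of K"
  shows "f ` K \<in> sets lebesgue" "measure lebesgue (f ` K) \<le> integral K (\<lambda>x. \<bar>f' x\<bar>)"
proof -
  have cf: "continuous_on {a..b} f"
    using deriv DERIV_continuous continuous_on_eq_continuous_within by blast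
  have "compact (f ` K)"
    using compact_continuous_image[OF continuous_on_subset[OF cf K(1)]] compact_if_division[OF K(2)]
    by blast
  then show "f ` K \<in> sets lebesgue" by (simp add: lmeasurable_compact fmeasurableD)
  have piece: "f ` i \<in> sets lebesgue \<and> measure lebesgue (f ` i) \<le> integral i (\<lambda>x. \<bar>f' x\<bar>)
      \<and> (\<lambda>x. \<bar>f' x\<bar>) integrable_on i" if "i \<in> d" for i
  proof -
    obtain u v where uv: "i = {u..v}" "i \<noteq> {}"
      using division_ofD(3,4)[OF K(2) \<open>i \<in> d\<close>] by (metis box_real(2))
    have sub: "{u..v} \<subseteq> {a..b}" using division_ofD(2)[OF K(2) that] K(1) uv by blast
    have "compact (f ` i)"
      using compact_continuous_image[OF continuous_on_subset[OF cf sub]] uv by auto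
    moreover have "measure lebesgue (f ` {u..v}) \<le> integral {u..v} (\<lambda>x. \<bar>f' x\<bar>)"
      using uv sub continuous_on_subset[OF cont sub]
      by (intro measure_interval_image_le_integral) (auto intro: DERIV_subset[OF deriv sub])
    moreover have "(\<lambda>x. \<bar>f' x\<bar>) integrable_on {u..v}"
      using continuous_on_subset[OF cont sub]
      by (auto intro!: integrable_continuous_interval continuous_intros)
    ultimately show ?thesis using uv by (auto simp: lmeasurable_compact fmeasurableD)
  qed
  have "f ` K = (\<Union>i\<in>d. f ` i)" using division_ofD(6)[OF K(2)] by auto
  then have "measure lebesgue (f ` K) \<le> (\<Sum>i\<in>d. measure lebesgue (f ` i))"
    using measure_UNION_le[of d "\<lambda>i. f ` i" lebesgue] division_ofD(1)[OF K(2)] piece by auto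
  also have "\<dots> \<le> (\<Sum>i\<in>d. integral i (\<lambda>x. \<bar>f' x\<bar>))"
    using piece by (intro sum_mono) auto
  also have "\<dots> = integral K (\<lambda>x. \<bar>f' x\<bar>)"
    using integral_combine_division_bottomup[OF K(2)] piece by metis
  finally show "measure lebesgue (f ` K) \<le> integral K (\<lambda>x. \<bar>f' x\<bar>)" .
qed

section \<open>Cauchy-Schwarz with a free parameter\<close>

text \<open>This is the pointwise inequality
  \<open>2 * r * \<bar>f' x\<bar> \<le> r\<^sup>2 + (f' x)\<^sup>2\<close> integrated over
  \<open>K\<close>. Both sides are linear in the data of the edge, so the bounds for all edges can
  be added with one common \<open>r\<close> before \<open>r\<close> is optimised.\<close>

lemma scaled_measure_image_le:
  fixes f f' :: "real \<Rightarrow> real"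
  assumes deriv: "\<And>x. x \<in> {a..b} \<Longrightarrow> (f has_real_derivative f' x) (at x within {a..b})"
    and cont: "continuous_on {a..b} f'"
    and K: "K \<subseteq> {a..b}" "d division_of K" and "r > 0"
  shows "2 * r * measure lebesgue (f ` K)
    \<le> r\<^sup>2 * measure lebesgue K + integral {a..b} (\<lambda>x. (f' x)\<^sup>2)"
proof -
  have cK: "compact K" by (rule compact_if_division[OF K(2)])
  then have lK: "K \<in> lmeasurable" by (simp add: lmeasurable_compact)
  have int_on_K: "h integrable_on K" if "continuous_on {a..b} h" for h :: "real \<Rightarrow> real"
  proof -
    have "h integrable_on i" if "i \<in> d" for i
    proof -
      obtain u v where uv: "i = {u..v}"
        using division_ofD(4)[OF K(2) \<open>i \<in> d\<close>] by (metis box_real(2))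
      then have "{u..v} \<subseteq> {a..b}" using division_ofD(2)[OF K(2) that] K(1) by blast
      then show ?thesis
        using uv \<open>continuous_on {a..b} h\<close> continuous_on_subset integrable_continuous_interval by metis
    qed
    then show ?thesis using integrable_combine_division[OF K(2)] by blast
  qed
  have i1: "(\<lambda>x. \<bar>f' x\<bar>) integrable_on K" and i2: "(\<lambda>x. (f' x)\<^sup>2) integrable_on K"
    using cont by (auto intro!: int_on_K continuous_intros)
  have i3: "(\<lambda>x. r\<^sup>2) integrable_on K" by (auto intro!: int_on_K continuous_intros)
  have c: "integral K (\<lambda>x. r\<^sup>2) = r\<^sup>2 * measure lebesgue K"
    using lmeasure_integral[OF lK] integral_mult_right[of K "r\<^sup>2" "\<lambda>x. 1"] by simp
  have "2 * r * measure lebesgue (f ` K) \<le> 2 * r * integral K (\<lambda>x. \<bar>f' x\<bar>)"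
    using measure_image_le_integral(2)[OF deriv cont K] \<open>r > 0\<close> by simp
  also have "\<dots> = integral K (\<lambda>x. 2 * r * \<bar>f' x\<bar>)" by simp
  also have "\<dots> \<le> integral K (\<lambda>x. r\<^sup>2 + (f' x)\<^sup>2)"
  proof (rule integral_le)
    show "(\<lambda>x. 2 * r * \<bar>f' x\<bar>) integrable_on K" using integrable_on_mult_right[OF i1] .
    show "(\<lambda>x. r\<^sup>2 + (f' x)\<^sup>2) integrable_on K" using integrable_add[OF i3 i2] .
    show "2 * r * \<bar>f' x\<bar> \<le> r\<^sup>2 + (f' x)\<^sup>2" for x
      using sum_squares_bound[of r "\<bar>f' x\<bar>"] by simp
  qed
  also have "\<dots> = r\<^sup>2 * measure lebesgue K + integral K (\<lambda>x. (f' x)\<^sup>2)"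
    using integral_add[OF i3 i2] c by simp
  \<comment> \<open>The integrand is nonnegative, so \<open>K\<close> may be enlarged to the whole
    edge. The energy term then no longer depends on the path.\<close>
  also have "integral K (\<lambda>x. (f' x)\<^sup>2) \<le> integral {a..b} (\<lambda>x. (f' x)\<^sup>2)"
    using K(1) i2 cont
    by (intro integral_subset_le) (auto intro!: integrable_continuous_interval continuous_intros)
  finally show ?thesis by simp
qed

text \<open>The right-hand side is optimised at \<open>r = D / c\<close>, which turns the
  parametrised bound back into Cauchy-Schwarz.\<close>

lemma square_le_mult_if_quadratic_bound:
  fixes D c E :: real
  assumes bound: "\<And>r. r > 0 \<Longrightarrow> 2 * r * D \<le> r\<^sup>2 * c + E" and "D \<ge> 0" "c \<ge> 0" "E \<ge> 0"
  shows "D\<^sup>2 \<le> c * E"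
proof (cases "D = 0")
  case True
  then show ?thesis using \<open>c \<ge> 0\<close> \<open>E \<ge> 0\<close> by simp
next
  case False
  then have D: "D > 0" using \<open>D \<ge> 0\<close> by simp
  show ?thesis
  proof (cases "c = 0")
    case True
    \<comment> \<open>With \<open>c = 0\<close> the left side grows without bound in
      \<open>r\<close>. This \<open>r\<close> makes it \<open>2 * (\<bar>E\<bar> + 1)\<close>, which
      exceeds \<open>E\<close>: a contradiction.\<close>
    then have "2 * ((\<bar>E\<bar> + 1) / D) * D \<le> E" using bound[of "(\<bar>E\<bar> + 1) / D"] D by (simp add: field_simps)
    then show ?thesis using D by simp
  next
    case False
    then have c: "c > 0" using \<open>c \<ge> 0\<close> by simp
    then have "2 * (D / c) * D \<le> (D / c)\<^sup>2 * c + E" using bound[of "D / c"] D by simp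
    then show ?thesis using c by (simp add: field_simps power2_eq_square)
  qed
qed

lemma continuous_nonneg_eq_0_if_integral_eq_0:
  fixes h :: "real \<Rightarrow> real"
  assumes "a < b" "continuous_on {a..b} h" "\<And>x. x \<in> {a..b} \<Longrightarrow> h x \<ge> 0"
    and "integral {a..b} h = 0" "x \<in> {a..b}"
  shows "h x = 0"
proof -
  have "(h has_integral 0) (cbox a b)"
    using integrable_integral[OF integrable_continuous_interval[OF assms(2)]] assms(4) by simp
  then show ?thesis
    using assms by (intro has_integral_0_cbox_imp_0[of a b h]) auto
qed


section \<open>Paths, diameter and energy\<close>

locale metric_graph = fin_digraph G for G :: "('v, 'e) pre_digraph" +
  fixes g :: "'e \<Rightarrow> real"
  assumes connected_graph: "Digraph_Component.connected G"
    and arcs_nonempty: "arcs G \<noteq> {}"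
    and metric_pos: "\<And>e. e \<in> arcs G \<Longrightarrow> g e > 0"
begin

abbreviation len :: "'e \<Rightarrow> real" where
  "len \<equiv> edge_length g"

abbreviation value_at :: "('e \<Rightarrow> real \<Rightarrow> real) \<Rightarrow> 'e \<times> real \<Rightarrow> real" where
  "value_at f p \<equiv> f (fst p) (snd p)"

lemma len_pos: "e \<in> arcs G \<Longrightarrow> len e > 0"
  using metric_pos by (simp add: edge_length_def)

lemma tail_lies_at: "e \<in> arcs G \<Longrightarrow> lies_at G g (tail G e) (e, 0)"
  and head_lies_at: "e \<in> arcs G \<Longrightarrow> lies_at G g (head G e) (e, len e)"
  using len_pos by (auto simp: lies_at_def graph_points_def less_imp_le)

lemma path_length_nonneg: "path_of_length G g p q c \<Longrightarrow> c \<ge> 0"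
  by (induction rule: path_of_length.induct) auto

lemma graph_dist_le: "path_of_length G g p q c \<Longrightarrow> graph_dist G g p q \<le> c"
  unfolding graph_dist_def
  by (intro cInf_lower bdd_belowI[of _ 0]) (auto dest: path_length_nonneg)

section \<open>Existence of paths and finiteness of the diameter\<close>

text \<open>Induction along a walk in the symmetrised graph. The end point \<open>q\<close> is
  generalised because one vertex is represented by several edge ends.\<close>

lemma ex_path_between_vertices:
  assumes "u \<in> verts G" "w \<in> verts G" "lies_at G g u p" "lies_at G g w q"
  shows "\<exists>c. path_of_length G g p q c"
proof -
  have "(u, w) \<in> (arcs_ends (mk_symmetric G))\<^sup>*"
    using connected_graph assms(1,2) reachable_rtranclI
    by (fastforce simp: Digraph_Component.connected_def strongly_connected_def)
  then show ?thesis using assms(4)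
  proof (induction arbitrary: q rule: rtrancl_induct)
    case base
    show ?case using path_of_length.vertex[OF assms(3) base] by blast
  next
    case (step y z)
    from step.hyps(2) obtain e where e: "e \<in> arcs G"
      "(y, z) = (tail G e, head G e) \<or> (y, z) = (head G e, tail G e)"
      by (auto simp: parcs_mk_symmetric)
    have pts: "(e, 0) \<in> graph_points G g" "(e, len e) \<in> graph_points G g"
      using e len_pos[OF e(1)] by (auto simp: graph_points_def)
    \<comment> \<open>The parameters \<open>a\<close> and \<open>b\<close> are \<open>0\<close> and
      \<open>len e\<close> in the order in which the walk crosses \<open>e\<close>, with or against
      its orientation.\<close>
    obtain a b where ab: "lies_at G g y (e, a)" "lies_at G g z (e, b)"
      "(e, a) \<in> graph_points G g" "(e, b) \<in> graph_points G g"
      using e(2) tail_lies_at[OF e(1)] head_lies_at[OF e(1)] pts by auto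
    obtain c where "path_of_length G g p (e, a) c" using step.IH[OF ab(1)] by blast
    then show ?case
      using path_of_length.segment[OF ab(3,4)] path_of_length.vertex[OF ab(2) step.prems]
        path_of_length.concat by metis
  qed
qed

text \<open>Any two points are joined through the tail ends of their edges, and there are only
  finitely many pairs of edges. The uniform bound shows that the supremum defining
  \<open>graph_diam\<close> is taken over a bounded set.\<close>

lemma ex_bounded_path:
  "\<exists>B. \<forall>p\<in>graph_points G g. \<forall>q\<in>graph_points G g. \<exists>c\<le>B. path_of_length G g p q c"
proof -
  have "\<exists>c. path_of_length G g (e, 0) (e', 0) c" if "e \<in> arcs G" "e' \<in> arcs G" for e e'
    using that ex_path_between_vertices[OF _ _ tail_lies_at tail_lies_at] by simp
  then obtain C where C: "\<And>e e'. e \<in> arcs G \<Longrightarrow> e' \<in> arcs G \<Longrightarrow>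
      path_of_length G g (e, 0) (e', 0) (C e e')"
    by metis
  \<comment> \<open>All summands are nonnegative, so the sum over all pairs of edges dominates each
    of them.\<close>
  define B where "B = (\<Sum>(e, e')\<in>arcs G \<times> arcs G. len e + C e e' + len e')"
  have "\<exists>c\<le>B. path_of_length G g p q c"
    if pq: "p \<in> graph_points G g" "q \<in> graph_points G g" for p q
  proof -
    obtain e s e' s' where eq: "p = (e, s)" "q = (e', s')" "e \<in> arcs G" "e' \<in> arcs G"
      "0 \<le> s" "s \<le> len e" "0 \<le> s'" "s' \<le> len e'"
      using pq by (auto simp: graph_points_def)
    have zeros: "(e, 0) \<in> graph_points G g" "(e', 0) \<in> graph_points G g"
      using eq len_pos by (auto simp: graph_points_def less_imp_le)
    have "path_of_length G g p q (\<bar>s - 0\<bar> + C e e' + \<bar>0 - s'\<bar>)"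
      using path_of_length.segment[of e s G g 0] path_of_length.segment[of e' 0 G g s'] C[OF eq(3,4)]
        pq zeros eq(1,2) path_of_length.concat by metis
    moreover have "\<bar>s - 0\<bar> + C e e' + \<bar>0 - s'\<bar> \<le> len e + C e e' + len e'"
      using eq by auto
    moreover have "len e + C e e' + len e' \<le> B"
    proof -
      have "0 \<le> (case x of (e, e') \<Rightarrow> len e + C e e' + len e')" if "x \<in> arcs G \<times> arcs G" for x
        using that len_pos path_length_nonneg[OF C] by (auto intro!: add_nonneg_nonneg dest: less_imp_le)
      then have "(case (e, e') of (e, e') \<Rightarrow> len e + C e e' + len e') \<le> B"
        unfolding B_def using eq(3,4) by (intro member_le_sum) auto
      then show ?thesis by simp
    qed
    ultimately show ?thesis by (meson order_trans)
  qed
  then show ?thesis by blast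
qed

lemma graph_dist_le_diam:
  assumes "p \<in> graph_points G g" "q \<in> graph_points G g"
  shows "graph_dist G g p q \<le> graph_diam G g"
proof -
  obtain B where B: "\<And>p q. p \<in> graph_points G g \<Longrightarrow> q \<in> graph_points G g \<Longrightarrow>
      \<exists>c\<le>B. path_of_length G g p q c"
    using ex_bounded_path by metis
  have "bdd_above ((\<lambda>(p, q). graph_dist G g p q) ` (graph_points G g \<times> graph_points G g))"
    by (rule bdd_aboveI2[of _ _ B]) (use B graph_dist_le order_trans in fastforce)
  from cSUP_upper[OF _ this, of "(p, q)"] show ?thesis
    using assms by (simp add: graph_diam_def)
qed

section \<open>Covering the values along a path\<close>

text \<open>A piece of a path on one edge, written as a family indexed by all edges that is empty
  off \<open>e\<close>. It serves both base cases of the path induction; for a change of edge end at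
  a vertex the interval is a single point.\<close>

lemma single_interval_cover:
  assumes "e \<in> arcs G" "a \<le> b" "0 \<le> a" "b \<le> len e"
  shows "\<exists>K. (\<forall>e\<in>arcs G. K e \<subseteq> {0..len e} \<and> (\<exists>d. d division_of K e)) \<and>
    (\<Sum>e\<in>arcs G. measure lebesgue (K e)) = b - a \<and> (\<Union>e\<in>arcs G. f e ` K e) = f e ` {a..b}"
proof -
  define K where "K = (\<lambda>e'. if e' = e then {a..b} else {})"
  have "(\<Sum>e\<in>arcs G. measure lebesgue (K e)) = (\<Sum>e'\<in>arcs G. if e' = e then b - a else 0)"
    using assms by (intro sum.cong) (auto simp: K_def)
  then have "(\<Sum>e\<in>arcs G. measure lebesgue (K e)) = b - a" using assms(1) by simp
  moreover have "\<exists>d. d division_of K e'" for e'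
    using elementary_interval[of a b] by (auto simp: K_def)
  moreover have "(\<Union>e\<in>arcs G. f e ` K e) = f e ` {a..b}"
    using assms(1) by (auto simp: K_def split: if_splits)
  moreover have "K e' \<subseteq> {0..len e'}" for e'
    using assms by (auto simp: K_def)
  ultimately show ?thesis by blast
qed

text \<open>Segments are handled by the intermediate value theorem and vertex steps by continuity at
  the vertex. Concatenation takes unions edge by edge, so a stretch traversed again adds no further
  measure, and subadditivity keeps the total below the path length.\<close>

lemma path_covers_value_segment:
  assumes "path_of_length G g p q c" and cont: "continuous_on_graph G g f"
  shows "\<exists>K. (\<forall>e\<in>arcs G. K e \<subseteq> {0..len e} \<and> (\<exists>d. d division_of K e)) \<and>
    (\<Sum>e\<in>arcs G. measure lebesgue (K e)) \<le> c \<and>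
    closed_segment (value_at f p) (value_at f q) \<subseteq> (\<Union>e\<in>arcs G. f e ` K e)"
  using assms(1)
proof (induction rule: path_of_length.induct)
  case (segment e s t)
  then have e: "e \<in> arcs G" "0 \<le> min s t" "max s t \<le> len e" "min s t \<le> max s t"
    by (auto simp: graph_points_def)
  have st: "{min s t..max s t} = closed_segment s t"
    by (auto simp: closed_segment_eq_real_ivl min_def max_def)
  have "continuous_on (closed_segment s t) (f e)"
    using cont e continuous_on_subset[of "{0..len e}" "f e" "{min s t..max s t}"]
    by (auto simp: continuous_on_graph_def simp flip: st)
  from closed_segment_subset_image[OF this]
  have "closed_segment (f e s) (f e t) \<subseteq> f e ` {min s t..max s t}" using st by simp
  moreover have "\<bar>s - t\<bar> = max s t - min s t" by auto
  moreover obtain K where "\<forall>e\<in>arcs G. K e \<subseteq> {0..len e} \<and> (\<exists>d. d division_of K e)"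
    "(\<Sum>e\<in>arcs G. measure lebesgue (K e)) = max s t - min s t"
    "(\<Union>e\<in>arcs G. f e ` K e) = f e ` {min s t..max s t}"
    using single_interval_cover[OF e(1,4,2,3), of f] by (elim exE conjE) (rule that)
  ultimately show ?case by (intro exI[of _ K]) simp
next
  case (vertex v p q)
  then have "value_at f p = value_at f q" using cont by (auto simp: continuous_on_graph_def)
  then have "closed_segment (value_at f p) (value_at f q) = f (fst p) ` {snd p..snd p}" by simp
  moreover have p: "fst p \<in> arcs G" "0 \<le> snd p" "snd p \<le> len (fst p)"
    using vertex by (auto simp: lies_at_def graph_points_def)
  obtain K where "\<forall>e\<in>arcs G. K e \<subseteq> {0..len e} \<and> (\<exists>d. d division_of K e)"
    "(\<Sum>e\<in>arcs G. measure lebesgue (K e)) = snd p - snd p"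
    "(\<Union>e\<in>arcs G. f e ` K e) = f (fst p) ` {snd p..snd p}"
    using single_interval_cover[OF p(1) order_refl p(2,3), of f] by (elim exE conjE) (rule that)
  ultimately show ?case by (intro exI[of _ K]) simp
next
  case (concat p q a r b)
  from concat.IH(1) obtain K where K: "\<forall>e\<in>arcs G. K e \<subseteq> {0..len e} \<and> (\<exists>d. d division_of K e)"
      "(\<Sum>e\<in>arcs G. measure lebesgue (K e)) \<le> a"
      "closed_segment (value_at f p) (value_at f q) \<subseteq> (\<Union>e\<in>arcs G. f e ` K e)"
    by (elim exE conjE) (rule that)
  from concat.IH(2) obtain K' where K': "\<forall>e\<in>arcs G. K' e \<subseteq> {0..len e} \<and> (\<exists>d. d division_of K' e)"
      "(\<Sum>e\<in>arcs G. measure lebesgue (K' e)) \<le> b"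
      "closed_segment (value_at f q) (value_at f r) \<subseteq> (\<Union>e\<in>arcs G. f e ` K' e)"
    by (elim exE conjE) (rule that)
  have "\<exists>d. d division_of (K e \<union> K' e)" if "e \<in> arcs G" for e
    using bspec[OF K(1) that] bspec[OF K'(1) that] elementary_union by metis
  moreover have "measure lebesgue (K e \<union> K' e) \<le> measure lebesgue (K e) + measure lebesgue (K' e)"
    if "e \<in> arcs G" for e
    using bspec[OF K(1) that] bspec[OF K'(1) that]
    by (intro measure_Un_le) (auto intro!: fmeasurableD lmeasurable_compact dest: compact_if_division)
  then have "(\<Sum>e\<in>arcs G. measure lebesgue (K e \<union> K' e)) \<le> a + b"
    using sum_mono[of "arcs G" "\<lambda>e. measure lebesgue (K e \<union> K' e)"
        "\<lambda>e. measure lebesgue (K e) + measure lebesgue (K' e)"] K(2) K'(2)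
    by (simp add: sum.distrib)
  \<comment> \<open>On the real line the interval between two values lies in the union of the two
    intervals that pass through a third value, wherever that value is.\<close>
  moreover have "closed_segment (value_at f p) (value_at f r)
      \<subseteq> closed_segment (value_at f p) (value_at f q) \<union> closed_segment (value_at f q) (value_at f r)"
    by (auto simp: closed_segment_eq_real_ivl split: if_splits)
  then have "closed_segment (value_at f p) (value_at f r) \<subseteq> (\<Union>e\<in>arcs G. f e ` (K e \<union> K' e))"
    using K(3) K'(3) by (simp add: image_Un UN_Un_distrib) blast
  ultimately show ?case
    using K(1) K'(1) by (intro exI[of _ "\<lambda>e. K e \<union> K' e"]) auto
qed

text \<open>The covering family bounds the difference of values by the total measure of its images.
  Adding the parametrised estimates over the edges then bounds \<open>2 * r\<close> times the
  difference for every \<open>r > 0\<close>.\<close>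

lemma square_diff_le_path_energy:
  assumes path: "path_of_length G g p q c" and cont: "continuous_on_graph G g f"
    and deriv: "\<And>e x. e \<in> arcs G \<Longrightarrow> x \<in> {0..len e} \<Longrightarrow>
      (f e has_real_derivative f' e x) (at x within {0..len e})"
    and cont': "\<And>e. e \<in> arcs G \<Longrightarrow> continuous_on {0..len e} (f' e)"
  shows "(value_at f p - value_at f q)\<^sup>2
    \<le> c * (\<Sum>e\<in>arcs G. integral {0..len e} (\<lambda>x. (f' e x)\<^sup>2))"
proof -
  from path_covers_value_segment[OF path cont]
  obtain K where K: "\<forall>e\<in>arcs G. K e \<subseteq> {0..len e} \<and> (\<exists>d. d division_of K e)"
      "(\<Sum>e\<in>arcs G. measure lebesgue (K e)) \<le> c"
      "closed_segment (value_at f p) (value_at f q) \<subseteq> (\<Union>e\<in>arcs G. f e ` K e)"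
    by (elim exE conjE) (rule that)
  have K_sub: "K e \<subseteq> {0..len e}" and K_div: "\<exists>d. d division_of K e" if "e \<in> arcs G" for e
    using K(1) that by auto
  let ?E = "\<Sum>e\<in>arcs G. integral {0..len e} (\<lambda>x. (f' e x)\<^sup>2)"
  have "compact (f e ` K e)" if "e \<in> arcs G" for e
    using K_sub[OF that] K_div[OF that] cont that compact_if_division
    by (metis compact_continuous_image continuous_on_graph_def continuous_on_subset)
  then have im: "f e ` K e \<in> lmeasurable" if "e \<in> arcs G" for e
    using that by (simp add: lmeasurable_compact)
  have "\<bar>value_at f p - value_at f q\<bar> = measure lebesgue (closed_segment (value_at f p) (value_at f q))"
    by (auto simp: closed_segment_eq_real_ivl)
  also have "\<dots> \<le> measure lebesgue (\<Union>e\<in>arcs G. f e ` K e)"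
    using K(3) im by (intro measure_mono_fmeasurable) (auto intro: fmeasurable.finite_UN)
  also have "\<dots> \<le> (\<Sum>e\<in>arcs G. measure lebesgue (f e ` K e))"
    using im by (intro measure_UNION_le) (auto intro: fmeasurableD)
  finally have D: "\<bar>value_at f p - value_at f q\<bar> \<le> (\<Sum>e\<in>arcs G. measure lebesgue (f e ` K e))" .
  have "\<bar>value_at f p - value_at f q\<bar>\<^sup>2 \<le> c * ?E"
  proof (rule square_le_mult_if_quadratic_bound)
    fix r :: real assume r: "r > 0"
    have "2 * r * \<bar>value_at f p - value_at f q\<bar> \<le> (\<Sum>e\<in>arcs G. 2 * r * measure lebesgue (f e ` K e))"
      using D r by (simp flip: sum_distrib_left)
    also have "\<dots> \<le> (\<Sum>e\<in>arcs G. r\<^sup>2 * measure lebesgue (K e) + integral {0..len e} (\<lambda>x. (f' e x)\<^sup>2))"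
    proof (rule sum_mono)
      fix e assume e: "e \<in> arcs G"
      obtain d where "d division_of K e" using K_div[OF e] by blast
      from scaled_measure_image_le[OF deriv[OF e] cont'[OF e] K_sub[OF e] this r]
      show "2 * r * measure lebesgue (f e ` K e)
        \<le> r\<^sup>2 * measure lebesgue (K e) + integral {0..len e} (\<lambda>x. (f' e x)\<^sup>2)" .
    qed
    also have "\<dots> \<le> r\<^sup>2 * c + ?E"
      using K(2) by (simp add: sum.distrib mult_left_mono flip: sum_distrib_left)
    finally show "2 * r * \<bar>value_at f p - value_at f q\<bar> \<le> r\<^sup>2 * c + ?E" .
  next
    show "?E \<ge> 0"
      using cont' by (intro sum_nonneg integral_nonneg)
        (auto intro!: integrable_continuous_interval continuous_intros)
  qed (use path_length_nonneg[OF path] in auto)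
  then show ?thesis by simp
qed

text \<open>The path estimate holds for every path from \<open>p\<close> to \<open>q\<close>;
  dividing by the energy makes the quotient a lower bound of all path lengths, hence of their
  infimum.\<close>

lemma square_diff_le_diam_energy:
  assumes pq: "p \<in> graph_points G g" "q \<in> graph_points G g" and cont: "continuous_on_graph G g f"
    and deriv: "\<And>e x. e \<in> arcs G \<Longrightarrow> x \<in> {0..len e} \<Longrightarrow>
      (f e has_real_derivative f' e x) (at x within {0..len e})"
    and cont': "\<And>e. e \<in> arcs G \<Longrightarrow> continuous_on {0..len e} (f' e)"
  shows "(value_at f p - value_at f q)\<^sup>2
    \<le> graph_diam G g * (\<Sum>e\<in>arcs G. integral {0..len e} (\<lambda>x. (f' e x)\<^sup>2))"
    (is "?D \<le> _ * ?E")
proof -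
  obtain c where c: "path_of_length G g p q c" using ex_bounded_path pq by blast
  note bound = square_diff_le_path_energy[OF _ cont deriv cont']
  have E: "?E \<ge> 0"
    using cont' by (intro sum_nonneg integral_nonneg)
      (auto intro!: integrable_continuous_interval continuous_intros)
  show ?thesis
  proof (cases "?E = 0")
    \<comment> \<open>Division is impossible here, but any single path already forces the difference
      to vanish.\<close>
    case True
    then show ?thesis using bound[OF c] by simp
  next
    case False
    then have E: "?E > 0" using E by simp
    have "?D / ?E \<le> graph_dist G g p q"
      unfolding graph_dist_def
      using c bound E by (intro cInf_greatest) (auto simp: field_simps)
    also have "\<dots> \<le> graph_diam G g" using pq by (rule graph_dist_le_diam)
    finally show ?thesis using E by (simp add: field_simps)
  qed
qed

end


section \<open>Eigenfunctions\<close>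

locale weighted_metric_graph = metric_graph +
  fixes \<rho> :: "'b \<Rightarrow> real \<Rightarrow> real"
  assumes density_continuous: "\<And>e. e \<in> arcs G \<Longrightarrow> continuous_on {0..len e} (\<rho> e)"
    and density_pos: "\<And>e x. e \<in> arcs G \<Longrightarrow> x \<in> {0..len e} \<Longrightarrow> \<rho> e x > 0"
begin

section \<open>Integration by parts on the graph\<close>

text \<open>Regrouping edge ends by vertex, \<open>h\<close> factors out by continuity and the
  Kirchhoff sum remains. The test function \<open>h\<close> is left free: \<open>1\<close> yields
  the mean value identity, \<open>f\<close> itself the energy identity.\<close>

lemma sum_boundary_terms_eq_0:
  assumes cont: "continuous_on_graph G g h"
    and kirchhoff: "\<And>v. v \<in> verts G \<Longrightarrow> (\<Sum>e | e \<in> arcs G \<and> tail G e = v. f' e 0) +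
          (\<Sum>e | e \<in> arcs G \<and> head G e = v. - f' e (len e)) = 0"
  shows "(\<Sum>e\<in>arcs G. h e (len e) * f' e (len e) - h e 0 * f' e (0::real)) = 0"
proof -
  \<comment> \<open>The value of \<open>h\<close> at the vertex \<open>v\<close>; by continuity the
    choice of the edge end is immaterial.\<close>
  define H where "H v = value_at h (SOME p. lies_at G g v p)" for v
  have H: "value_at h p = H v" if "lies_at G g v p" for v p
    using someI[of "lies_at G g v" p] that cont unfolding H_def continuous_on_graph_def by blast
  have tail: "h e 0 = H (tail G e)" and head: "h e (len e) = H (head G e)" if "e \<in> arcs G" for e
    using H[OF tail_lies_at[OF that]] H[OF head_lies_at[OF that]] by auto
  have heads: "(\<Sum>e\<in>arcs G. h e (len e) * f' e (len e))
      = (\<Sum>v\<in>verts G. H v * (\<Sum>e | e \<in> arcs G \<and> head G e = v. f' e (len e)))" (is "_ = ?rhs")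
  proof -
    have "(\<Sum>e\<in>arcs G. h e (len e) * f' e (len e))
        = (\<Sum>v\<in>verts G. \<Sum>e | e \<in> arcs G \<and> head G e = v. h e (len e) * f' e (len e))"
      by (subst sum.group) auto
    also have "\<dots> = ?rhs"
      by (intro sum.cong) (auto simp: head sum_distrib_left)
    finally show ?thesis .
  qed
  have tails: "(\<Sum>e\<in>arcs G. h e 0 * f' e 0)
      = (\<Sum>v\<in>verts G. H v * (\<Sum>e | e \<in> arcs G \<and> tail G e = v. f' e 0))" (is "_ = ?rhs")
  proof -
    have "(\<Sum>e\<in>arcs G. h e 0 * f' e 0)
        = (\<Sum>v\<in>verts G. \<Sum>e | e \<in> arcs G \<and> tail G e = v. h e 0 * f' e 0)"
      by (subst sum.group) auto
    also have "\<dots> = ?rhs"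
      by (intro sum.cong) (auto simp: tail sum_distrib_left)
    finally show ?thesis .
  qed
  have "(\<Sum>e | e \<in> arcs G \<and> tail G e = v. f' e 0) =
      (\<Sum>e | e \<in> arcs G \<and> head G e = v. f' e (len e))" if "v \<in> verts G" for v
    using kirchhoff[OF that] by (simp add: sum_negf)
  then show ?thesis
    by (simp add: sum_subtractf heads tails)
qed

text \<open>The equation is integrated against \<open>1\<close> and against \<open>f\<close>. The
  factor \<open>\<mu>\<close> stays in the mean value identity so that \<open>\<mu> = 0\<close> is
  covered as well.\<close>

lemma eigenfunction_derivative:
  assumes "solves_eigenproblem G g \<rho> \<mu> f"
  obtains f' where
    "\<forall>e\<in>arcs G. \<forall>x\<in>{0..len e}. (f e has_real_derivative f' e x) (at x within {0..len e})"
    "\<forall>e\<in>arcs G. continuous_on {0..len e} (f' e)"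
    "\<mu> * (\<Sum>e\<in>arcs G. integral {0..len e} (\<lambda>x. \<rho> e x * f e x)) = 0"
    "(\<Sum>e\<in>arcs G. integral {0..len e} (\<lambda>x. (f' e x)\<^sup>2))
      = \<mu> * (\<Sum>e\<in>arcs G. integral {0..len e} (\<lambda>x. \<rho> e x * (f e x)\<^sup>2))"
proof -
  obtain f' f'' where
    eqs: "\<forall>e\<in>arcs G. \<forall>x\<in>{0..len e}.
          (f e has_real_derivative f' e x) (at x within {0..len e}) \<and>
          (f' e has_real_derivative f'' e x) (at x within {0..len e}) \<and>
          - f'' e x = \<mu> * \<rho> e x * f e x"
    and vertex: "\<forall>v\<in>verts G. (\<Sum>e | e \<in> arcs G \<and> tail G e = v. f' e 0) +
          (\<Sum>e | e \<in> arcs G \<and> head G e = v. - f' e (len e)) = 0"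
    using assms unfolding solves_eigenproblem_def by blast
  have d: "(f e has_real_derivative f' e x) (at x within {0..len e})"
    and d': "(f' e has_real_derivative f'' e x) (at x within {0..len e})"
    and ode: "f'' e x = - (\<mu> * \<rho> e x * f e x)"
    if "e \<in> arcs G" "x \<in> {0..len e}" for e x
    using bspec[OF bspec[OF eqs that(1)] that(2)] by auto
  note kirchhoff = bspec[OF vertex]
  have cont: "continuous_on_graph G g f" using assms by (simp add: solves_eigenproblem_def)
  have cf: "continuous_on {0..len e} (f e)" if "e \<in> arcs G" for e
    using cont that by (auto simp: continuous_on_graph_def)
  have cf': "continuous_on {0..len e} (f' e)" if "e \<in> arcs G" for e
    using d'[OF that] DERIV_continuous continuous_on_eq_continuous_within by blast
  \<comment> \<open>The factors \<open>1\<close> bring the boundary terms into the shape of the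
    vertex summation with constant test function.\<close>
  have flux: "- (\<mu> * integral {0..len e} (\<lambda>x. \<rho> e x * f e x)) = 1 * f' e (len e) - 1 * f' e 0"
    if e: "e \<in> arcs G" for e
  proof -
    have "(f'' e has_integral (f' e (len e) - f' e 0)) {0..len e}"
      using len_pos[OF e] d'[OF e]
      by (intro fundamental_theorem_of_calculus)
        (auto simp flip: has_real_derivative_iff_has_vector_derivative)
    then have "((\<lambda>x. - \<mu> * (\<rho> e x * f e x)) has_integral (f' e (len e) - f' e 0)) {0..len e}"
      by (rule has_integral_eq[rotated]) (simp add: ode[OF e])
    then have "integral {0..len e} (\<lambda>x. - \<mu> * (\<rho> e x * f e x)) = f' e (len e) - f' e 0"
      by (rule integral_unique)
    then show ?thesis by simp
  qed
  have "- (\<mu> * (\<Sum>e\<in>arcs G. integral {0..len e} (\<lambda>x. \<rho> e x * f e x)))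
      = (\<Sum>e\<in>arcs G. 1 * f' e (len e) - 1 * f' e 0)"
    using flux by (simp add: sum_distrib_left flip: sum_negf)
  also have "\<dots> = 0"
    by (rule sum_boundary_terms_eq_0[OF _ kirchhoff, of "\<lambda>_ _. 1"])
      (auto simp: continuous_on_graph_def)
  finally have mean: "\<mu> * (\<Sum>e\<in>arcs G. integral {0..len e} (\<lambda>x. \<rho> e x * f e x)) = 0" by simp
  have energy: "integral {0..len e} (\<lambda>x. (f' e x)\<^sup>2)
      = \<mu> * integral {0..len e} (\<lambda>x. \<rho> e x * (f e x)\<^sup>2) + (f e (len e) * f' e (len e) - f e 0 * f' e 0)"
    if e: "e \<in> arcs G" for e
  proof -
    \<comment> \<open>Integrating the derivative of \<open>f * f'\<close> and replacing
      \<open>f''\<close> by means of the equation gives the energy identity on one edge, with its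
      boundary terms.\<close>
    have "((\<lambda>x. f e x * f' e x) has_real_derivative f e x * f'' e x + f' e x * f' e x)
        (at x within {0..len e})" if "x \<in> {0..len e}" for x
      using DERIV_mult'[OF d[OF e that] d'[OF e that]] .
    then have "((\<lambda>x. f e x * f'' e x + f' e x * f' e x) has_integral
        (f e (len e) * f' e (len e) - f e 0 * f' e 0)) {0..len e}"
      using len_pos[OF e]
      by (intro fundamental_theorem_of_calculus)
        (auto simp flip: has_real_derivative_iff_has_vector_derivative)
    then have parts: "((\<lambda>x. (f' e x)\<^sup>2 - \<mu> * (\<rho> e x * (f e x)\<^sup>2)) has_integral
        (f e (len e) * f' e (len e) - f e 0 * f' e 0)) {0..len e}"
      by (rule has_integral_eq[rotated]) (simp add: ode[OF e] power2_eq_square algebra_simps)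
    have ints: "(\<lambda>x. (f' e x)\<^sup>2) integrable_on {0..len e}"
        "(\<lambda>x. \<mu> * (\<rho> e x * (f e x)\<^sup>2)) integrable_on {0..len e}"
      using cf[OF e] cf'[OF e] density_continuous[OF e]
      by (auto intro!: integrable_continuous_interval continuous_intros)
    have "integral {0..len e} (\<lambda>x. (f' e x)\<^sup>2 - \<mu> * (\<rho> e x * (f e x)\<^sup>2))
        = integral {0..len e} (\<lambda>x. (f' e x)\<^sup>2) - \<mu> * integral {0..len e} (\<lambda>x. \<rho> e x * (f e x)\<^sup>2)"
      using integral_diff[OF ints] by simp
    then show ?thesis using integral_unique[OF parts] by simp
  qed
  have "(\<Sum>e\<in>arcs G. integral {0..len e} (\<lambda>x. (f' e x)\<^sup>2))
      = \<mu> * (\<Sum>e\<in>arcs G. integral {0..len e} (\<lambda>x. \<rho> e x * (f e x)\<^sup>2))"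
    using energy sum_boundary_terms_eq_0[OF cont kirchhoff]
    by (simp add: sum.distrib sum_distrib_left)
  then show thesis using that[OF _ _ mean] d cf' by blast
qed

text \<open>A continuous nonnegative integrand with vanishing integral is zero, and
  \<open>\<rho>\<close> is positive. The lemma is applied to the square of an eigenfunction, and to
  an eigenfunction assumed nonnegative.\<close>

lemma weighted_integral_pos:
  assumes cont: "\<And>e. e \<in> arcs G \<Longrightarrow> continuous_on {0..len e} (h e)"
    and nonneg: "\<And>e x. e \<in> arcs G \<Longrightarrow> x \<in> {0..len e} \<Longrightarrow> h e x \<ge> 0"
    and p: "p \<in> graph_points G g" "value_at h p \<noteq> 0"
  shows "(\<Sum>e\<in>arcs G. integral {0..len e} (\<lambda>x. \<rho> e x * h e x)) > 0"
proof -
  have c: "continuous_on {0..len e} (\<lambda>x. \<rho> e x * h e x)" if "e \<in> arcs G" for e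
    using cont[OF that] density_continuous[OF that] by (intro continuous_intros)
  have n: "\<rho> e x * h e x \<ge> 0" if "e \<in> arcs G" "x \<in> {0..len e}" for e x
    using nonneg[OF that] density_pos[OF that] by simp
  have int: "integral {0..len e} (\<lambda>x. \<rho> e x * h e x) \<ge> 0" if "e \<in> arcs G" for e
    using that c n by (intro integral_nonneg integrable_continuous_interval) auto
  obtain e x where ex: "p = (e, x)" "e \<in> arcs G" "x \<in> {0..len e}"
    using p(1) by (auto simp: graph_points_def)
  have "integral {0..len e} (\<lambda>x. \<rho> e x * h e x) \<noteq> 0"
    using continuous_nonneg_eq_0_if_integral_eq_0[OF len_pos c n _ ex(3)] ex p(2) density_pos[OF ex(2,3)]
    by fastforce
  then show ?thesis
    using ex(2) int by (intro sum_pos2[of _ e]) (auto simp: less_le)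
qed

lemma continuous_on_graph_attains_max_abs:
  assumes "continuous_on_graph G g f"
  obtains p where "p \<in> graph_points G g"
    "\<And>q. q \<in> graph_points G g \<Longrightarrow> \<bar>value_at f q\<bar> \<le> \<bar>value_at f p\<bar>"
proof -
  have "\<exists>t\<in>{0..len e}. \<forall>s\<in>{0..len e}. \<bar>f e s\<bar> \<le> \<bar>f e t\<bar>" if "e \<in> arcs G" for e
    using assms that len_pos[OF that]
    by (intro continuous_attains_sup) (auto simp: continuous_on_graph_def intro!: continuous_intros)
  then obtain t where t: "\<And>e. e \<in> arcs G \<Longrightarrow> t e \<in> {0..len e}"
    "\<And>e s. e \<in> arcs G \<Longrightarrow> s \<in> {0..len e} \<Longrightarrow> \<bar>f e s\<bar> \<le> \<bar>f e (t e)\<bar>"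
    by metis
  have fin: "finite ((\<lambda>e. \<bar>f e (t e)\<bar>) ` arcs G)" "(\<lambda>e. \<bar>f e (t e)\<bar>) ` arcs G \<noteq> {}"
    using arcs_nonempty by auto
  obtain e where e: "e \<in> arcs G" "\<bar>f e (t e)\<bar> = Max ((\<lambda>e. \<bar>f e (t e)\<bar>) ` arcs G)"
    using Max_in[OF fin] by auto
  show thesis
  proof (rule that[of "(e, t e)"])
    show "(e, t e) \<in> graph_points G g" using t(1)[OF e(1)] e(1) by (auto simp: graph_points_def)
    fix q assume "q \<in> graph_points G g"
    then have q: "fst q \<in> arcs G" "snd q \<in> {0..len (fst q)}" by (auto simp: graph_points_def)
    have "\<bar>value_at f q\<bar> \<le> \<bar>f (fst q) (t (fst q))\<bar>" using t(2)[OF q] .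
    also have "\<dots> \<le> \<bar>f e (t e)\<bar>" unfolding e(2) using fin(1) q(1) by (intro Max_ge) auto
    finally show "\<bar>value_at f q\<bar> \<le> \<bar>value_at f (e, t e)\<bar>" by simp
  qed
qed

text \<open>Allows the sign of an eigenfunction to be chosen so that its largest absolute value is
  attained as a positive value.\<close>

lemma solves_eigenproblem_uminus:
  assumes "solves_eigenproblem G g \<rho> \<mu> f"
  shows "solves_eigenproblem G g \<rho> \<mu> (\<lambda>e x. - f e x)"
proof -
  obtain f' f'' where
    d: "\<forall>e\<in>arcs G. \<forall>x\<in>{0..len e}.
          (f e has_real_derivative f' e x) (at x within {0..len e}) \<and>
          (f' e has_real_derivative f'' e x) (at x within {0..len e}) \<and>
          - f'' e x = \<mu> * \<rho> e x * f e x"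
    and k: "\<forall>v\<in>verts G. (\<Sum>e | e \<in> arcs G \<and> tail G e = v. f' e 0) +
          (\<Sum>e | e \<in> arcs G \<and> head G e = v. - f' e (len e)) = 0"
    and c: "continuous_on_graph G g f"
    using assms unfolding solves_eigenproblem_def by blast
  show ?thesis
    unfolding solves_eigenproblem_def
  proof (rule conjI, goal_cases)
    case 1
    show ?case
      using c unfolding continuous_on_graph_def by (auto intro: continuous_on_minus)
  next
    case 2
    show ?case
    proof (rule exI[of _ "\<lambda>e x. - f' e x"], rule exI[of _ "\<lambda>e x. - f'' e x"], intro conjI ballI)
      fix v assume "v \<in> verts G"
      with k have "(\<Sum>e | e \<in> arcs G \<and> tail G e = v. f' e 0) =
            (\<Sum>e | e \<in> arcs G \<and> head G e = v. f' e (len e))" by (simp add: sum_negf)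
      then show "(\<Sum>e | e \<in> arcs G \<and> tail G e = v. - f' e 0) +
          (\<Sum>e | e \<in> arcs G \<and> head G e = v. - (- f' e (len e))) = 0" by (simp add: sum_negf)
    next
      fix e x assume ex: "e \<in> arcs G" "x \<in> {0..len e}"
      note dx = bspec[OF bspec[OF d ex(1)] ex(2)]
      show "((\<lambda>x. - f e x) has_real_derivative - f' e x) (at x within {0..len e})"
        "((\<lambda>x. - f' e x) has_real_derivative - f'' e x) (at x within {0..len e})"
        using dx by (intro DERIV_minus; simp)+
      show "- (- f'' e x) = \<mu> * \<rho> e x * - f e x" using dx by simp
    qed
  qed
qed

section \<open>Sign of the eigenvalues and the kernel\<close>

text \<open>By the energy identity \<open>\<mu>\<close> times a positive weighted norm is a
  nonnegative energy.\<close>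

lemma eigenvalue_nonneg:
  assumes sol: "solves_eigenproblem G g \<rho> \<mu> f"
    and p: "p \<in> graph_points G g" "value_at f p \<noteq> 0"
  shows "\<mu> \<ge> 0"
proof -
  obtain f' where f':
    "\<forall>e\<in>arcs G. \<forall>x\<in>{0..len e}. (f e has_real_derivative f' e x) (at x within {0..len e})"
    "\<forall>e\<in>arcs G. continuous_on {0..len e} (f' e)"
    "\<mu> * (\<Sum>e\<in>arcs G. integral {0..len e} (\<lambda>x. \<rho> e x * f e x)) = 0"
    "(\<Sum>e\<in>arcs G. integral {0..len e} (\<lambda>x. (f' e x)\<^sup>2))
      = \<mu> * (\<Sum>e\<in>arcs G. integral {0..len e} (\<lambda>x. \<rho> e x * (f e x)\<^sup>2))"
    by (rule eigenfunction_derivative[OF sol])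
  have "(\<Sum>e\<in>arcs G. integral {0..len e} (\<lambda>x. (f' e x)\<^sup>2)) \<ge> 0"
    using f'(2) by (intro sum_nonneg integral_nonneg)
      (auto intro!: integrable_continuous_interval continuous_intros)
  moreover have "(\<Sum>e\<in>arcs G. integral {0..len e} (\<lambda>x. \<rho> e x * (f e x)\<^sup>2)) > 0"
    using sol p
    by (intro weighted_integral_pos[of "\<lambda>e x. (f e x)\<^sup>2" p])
      (auto simp: solves_eigenproblem_def continuous_on_graph_def intro!: continuous_intros)
  ultimately show ?thesis using f'(4) by (simp add: zero_le_mult_iff)
qed

text \<open>For \<open>\<mu> = 0\<close> the energy vanishes, and the diameter estimate bounds every
  difference of values by a multiple of it.\<close>

lemma zero_eigenfunction_constant:
  assumes sol: "solves_eigenproblem G g \<rho> 0 f"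
    and pq: "p \<in> graph_points G g" "q \<in> graph_points G g"
  shows "value_at f p = value_at f q"
proof -
  obtain f' where f':
    "\<forall>e\<in>arcs G. \<forall>x\<in>{0..len e}. (f e has_real_derivative f' e x) (at x within {0..len e})"
    "\<forall>e\<in>arcs G. continuous_on {0..len e} (f' e)"
    "0 * (\<Sum>e\<in>arcs G. integral {0..len e} (\<lambda>x. \<rho> e x * f e x)) = 0"
    "(\<Sum>e\<in>arcs G. integral {0..len e} (\<lambda>x. (f' e x)\<^sup>2))
      = 0 * (\<Sum>e\<in>arcs G. integral {0..len e} (\<lambda>x. \<rho> e x * (f e x)\<^sup>2))"
    by (rule eigenfunction_derivative[OF sol])
  have "continuous_on_graph G g f" using sol by (simp add: solves_eigenproblem_def)
  from square_diff_le_diam_energy[OF pq this bspec[OF bspec[OF f'(1)]] bspec[OF f'(2)]] f'(4) show ?thesis by simp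
qed

section \<open>The lower bound for a positive eigenvalue\<close>

lemma diam_mass_bound_at_positive_max:
  assumes sol: "solves_eigenproblem G g \<rho> \<mu> f" and "\<mu> > 0"
    and p: "p \<in> graph_points G g" "value_at f p > 0"
    and max: "\<And>q. q \<in> graph_points G g \<Longrightarrow> \<bar>value_at f q\<bar> \<le> value_at f p"
  shows "1 < graph_diam G g * (\<mu> * total_mass G g \<rho>)"
proof -
  obtain f' where f':
    "\<forall>e\<in>arcs G. \<forall>x\<in>{0..len e}. (f e has_real_derivative f' e x) (at x within {0..len e})"
    "\<forall>e\<in>arcs G. continuous_on {0..len e} (f' e)"
    "\<mu> * (\<Sum>e\<in>arcs G. integral {0..len e} (\<lambda>x. \<rho> e x * f e x)) = 0"
    "(\<Sum>e\<in>arcs G. integral {0..len e} (\<lambda>x. (f' e x)\<^sup>2))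
      = \<mu> * (\<Sum>e\<in>arcs G. integral {0..len e} (\<lambda>x. \<rho> e x * (f e x)\<^sup>2))" (is "?E = \<mu> * ?S")
    by (rule eigenfunction_derivative[OF sol])
  have cont: "continuous_on_graph G g f" using sol by (simp add: solves_eigenproblem_def)
  then have cf: "continuous_on {0..len e} (f e)" if "e \<in> arcs G" for e
    using that by (auto simp: continuous_on_graph_def)
  let ?M = "value_at f p"
  \<comment> \<open>Otherwise \<open>f\<close> is nonnegative and positive at \<open>p\<close>, so
    its weighted integral would be positive, against the mean value identity with
    \<open>\<mu> > 0\<close>.\<close>
  have "\<exists>q\<in>graph_points G g. value_at f q < 0"
  proof (rule ccontr)
    assume "\<not> ?thesis"
    then have "f e x \<ge> 0" if "e \<in> arcs G" "x \<in> {0..len e}" for e x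
      using that by (force simp: graph_points_def)
    then have "(\<Sum>e\<in>arcs G. integral {0..len e} (\<lambda>x. \<rho> e x * f e x)) > 0"
      using weighted_integral_pos[of f p] cf p by auto
    then show False using f'(3) \<open>\<mu> > 0\<close> by simp
  qed
  then obtain q where q: "q \<in> graph_points G g" "value_at f q < 0" by blast
  \<comment> \<open>The strict inequality of the theorem originates here, from \<open>f\<close>
    being negative at \<open>q\<close>.\<close>
  have "?M\<^sup>2 < (?M - value_at f q)\<^sup>2"
    using p(2) q(2) by (intro power_strict_mono) auto
  also have "\<dots> \<le> graph_diam G g * ?E"
    using square_diff_le_diam_energy[OF p(1) q(1) cont bspec[OF bspec[OF f'(1)]] bspec[OF f'(2)]] by simp
  finally have lower: "?M\<^sup>2 < graph_diam G g * (\<mu> * ?S)" using f'(4) by simp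
  have "?S > 0"
    using p cf by (intro weighted_integral_pos[of "\<lambda>e x. (f e x)\<^sup>2" p]) (auto intro!: continuous_intros)
  then have "\<mu> * ?S > 0" using \<open>\<mu> > 0\<close> by simp
  moreover have "0 < graph_diam G g * (\<mu> * ?S)"
    using zero_le_power2[of ?M] lower by (rule le_less_trans)
  \<comment> \<open>Positivity of the diameter is read off from the estimate itself: its product
    with the positive energy is positive.\<close>
  ultimately have diam: "graph_diam G g > 0"
    by (rule zero_less_mult_pos2[rotated])
  have "?S \<le> (\<Sum>e\<in>arcs G. integral {0..len e} (\<lambda>x. ?M\<^sup>2 * \<rho> e x))"
  proof (intro sum_mono integral_le)
    fix e assume e: "e \<in> arcs G"
    show "(\<lambda>x. \<rho> e x * (f e x)\<^sup>2) integrable_on {0..len e}"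
      "(\<lambda>x. ?M\<^sup>2 * \<rho> e x) integrable_on {0..len e}"
      using cf[OF e] density_continuous[OF e]
      by (auto intro!: integrable_continuous_interval continuous_intros)
    fix x assume x: "x \<in> {0..len e}"
    have "\<bar>f e x\<bar> \<le> ?M" using max[of "(e, x)"] e x by (auto simp: graph_points_def)
    then have "(f e x)\<^sup>2 \<le> ?M\<^sup>2" by (metis abs_ge_zero power2_abs power_mono)
    then show "\<rho> e x * (f e x)\<^sup>2 \<le> ?M\<^sup>2 * \<rho> e x"
      using density_pos[OF e x] by (simp add: mult.commute)
  qed
  also have "\<dots> = ?M\<^sup>2 * total_mass G g \<rho>"
    by (simp add: total_mass_def sum_distrib_left)
  finally have "graph_diam G g * (\<mu> * ?S) \<le> graph_diam G g * (\<mu> * (?M\<^sup>2 * total_mass G g \<rho>))"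
    using diam \<open>\<mu> > 0\<close> by simp
  with lower have "?M\<^sup>2 * 1 < ?M\<^sup>2 * (graph_diam G g * (\<mu> * total_mass G g \<rho>))"
    by (simp add: algebra_simps)
  then show ?thesis using p(2) by (simp only: mult_less_cancel_left_pos zero_less_power)
qed

lemma diam_mass_bound:
  assumes sol: "solves_eigenproblem G g \<rho> \<mu> f" and "\<mu> > 0"
    and p: "p \<in> graph_points G g" "value_at f p \<noteq> 0"
  shows "1 < graph_diam G g * (\<mu> * total_mass G g \<rho>)"
proof -
  have "continuous_on_graph G g f" using sol by (simp add: solves_eigenproblem_def)
  then obtain m where m: "m \<in> graph_points G g"
    "\<And>q. q \<in> graph_points G g \<Longrightarrow> \<bar>value_at f q\<bar> \<le> \<bar>value_at f m\<bar>"
    using continuous_on_graph_attains_max_abs by blast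
  then have "value_at f m \<noteq> 0" using m(2)[OF p(1)] p(2) by auto
  then consider "value_at f m > 0" | "value_at f m < 0" by linarith
  then show ?thesis
  proof cases
    case 1
    then show ?thesis using diam_mass_bound_at_positive_max[OF sol \<open>\<mu> > 0\<close> m(1)] m(2) by simp
  next
    case 2
    then show ?thesis
      using diam_mass_bound_at_positive_max[OF solves_eigenproblem_uminus[OF sol] \<open>\<mu> > 0\<close> m(1)] m(2)
      by simp
  qed
qed

section \<open>Multiplicities and the list of eigenvalues\<close>

lemma multiplicity_of_pos_imp_eigenfunction:
  assumes "multiplicity_of G g \<rho> \<mu> > 0"
  obtains f p where "solves_eigenproblem G g \<rho> \<mu> f" "p \<in> graph_points G g" "value_at f p \<noteq> 0"
proof -
  interpret vector_space fun_scale by (rule vector_space_fun_scale)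
  have "\<not> eigenspace G g \<rho> \<mu> \<subseteq> {0}"
    using dim_le_card[of "eigenspace G g \<rho> \<mu>" "{}"] assms by (auto simp: multiplicity_of_def)
  then obtain f where f: "f \<in> eigenspace G g \<rho> \<mu>" "f \<noteq> 0" by auto
  then obtain e x where "f e x \<noteq> 0" by (auto simp: fun_eq_iff)
  \<comment> \<open>Members of the eigenspace vanish off the graph, so a nonzero value can only
    occur at a point of the graph.\<close>
  then show thesis using f that[of f "(e, x)"] by (auto simp: eigenspace_def)
qed

lemma multiplicity_of_zero_le_1: "multiplicity_of G g \<rho> 0 \<le> 1"
proof -
  interpret vector_space fun_scale by (rule vector_space_fun_scale)
  \<comment> \<open>The constant function \<open>1\<close>, normalised to vanish off the graph; it
    spans the kernel.\<close>
  define c :: "'b \<Rightarrow> real \<Rightarrow> real" where "c e x = (if (e, x) \<in> graph_points G g then 1 else 0)" for e x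
  obtain e where "e \<in> arcs G" using arcs_nonempty by blast
  then have p: "(e, 0) \<in> graph_points G g" using len_pos by (auto simp: graph_points_def less_imp_le)
  have "f \<in> span {c}" if "f \<in> eigenspace G g \<rho> 0" for f
  proof -
    have "f = fun_scale (f e 0) c"
      using that zero_eigenfunction_constant[OF _ _ p, of f]
      by (fastforce simp: eigenspace_def fun_scale_def c_def fun_eq_iff)
    then show ?thesis using span_scale[OF span_base[of c "{c}"]] by (metis singletonI)
  qed
  then show ?thesis
    using dim_le_card[of "eigenspace G g \<rho> 0" "{c}"] by (auto simp: multiplicity_of_def)
qed

lemma first_eigenvalue:
  assumes seq: "eigenvalue_sequence G g \<rho> lam"
  shows "lam 1 > 0" "multiplicity_of G g \<rho> (lam 1) > 0"
proof -
  have fin: "finite {k. lam k = \<mu>}" and card: "card {k. lam k = \<mu>} = multiplicity_of G g \<rho> \<mu>" for \<mu>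
    using seq by (auto simp: eigenvalue_sequence_def)
  \<comment> \<open>The index \<open>k\<close> itself lies in the finite set of indices whose
    cardinality is the multiplicity.\<close>
  have mult: "multiplicity_of G g \<rho> (lam k) > 0" for k
    using fin[of "lam k"] card[of "lam k"] card_gt_0_iff[of "{j. lam j = lam k}"] by auto
  have nonneg: "lam k \<ge> 0" for k
    using multiplicity_of_pos_imp_eigenfunction[OF mult] eigenvalue_nonneg by metis
  have "lam 0 \<le> lam 1" using seq by (auto simp: eigenvalue_sequence_def dest: monoD)
  have "lam 1 \<noteq> 0"
  proof
    assume "lam 1 = 0"
    then have "lam 0 = 0" using \<open>lam 0 \<le> lam 1\<close> nonneg[of 0] by simp
    \<comment> \<open>If \<open>lam 1\<close> were \<open>0\<close>, so would be
      \<open>lam 0\<close>, and \<open>0\<close> would be listed at least twice although its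
      multiplicity is at most one.\<close>
    then have "card {0, 1 :: nat} \<le> card {k. lam k = 0}"
      using \<open>lam 1 = 0\<close> fin by (intro card_mono) auto
    then show False using card[of 0] multiplicity_of_zero_le_1 by simp
  qed
  then show "lam 1 > 0" using nonneg[of 1] by simp
  show "multiplicity_of G g \<rho> (lam 1) > 0" by (rule mult)
qed

end

theorem proposition5p12:
  fixes G :: "('v, 'e) pre_digraph"
    and g :: "'e \<Rightarrow> real"
    and \<rho> :: "'e \<Rightarrow> real \<Rightarrow> real"
    and lam :: "nat \<Rightarrow> real"
  assumes "fin_digraph G"
    and "Digraph_Component.connected G"
    and "arcs G \<noteq> {}"
    and "(g, \<rho>) \<in> admissible_pairs G"
    and "eigenvalue_sequence G g \<rho> lam"
  shows "normalized_eigenvalue G g \<rho> (lam 1) > total_length G g / graph_diam G g"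
proof -
  interpret fin_digraph G by (rule assms(1))
  interpret weighted_metric_graph G g \<rho>
  proof
    show "Digraph_Component.connected G" "arcs G \<noteq> {}" by (fact assms(2,3))+
    fix e assume e: "e \<in> arcs G"
    then show "g e > 0" using assms(4) by (auto simp: admissible_pairs_def)
    have "smooth_upto_ends (edge_length g e) (\<rho> e)" using e assms(4) by (auto simp: admissible_pairs_def)
    then show "continuous_on {0..edge_length g e} (\<rho> e)"
      unfolding smooth_upto_ends_def
      by (metis DERIV_continuous continuous_on_eq_continuous_within)
    show "\<rho> e x > 0" if "x \<in> {0..edge_length g e}" for x
      using e that assms(4) by (auto simp: admissible_pairs_def)
  qed
  obtain f p where "solves_eigenproblem G g \<rho> (lam 1) f" "p \<in> graph_points G g" "value_at f p \<noteq> 0"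
    using multiplicity_of_pos_imp_eigenfunction[OF first_eigenvalue(2)[OF assms(5)]] .
  then have bound: "1 < graph_diam G g * (lam 1 * total_mass G g \<rho>)"
    using diam_mass_bound first_eigenvalue(1)[OF assms(5)] by blast
  have mass: "total_mass G g \<rho> \<ge> 0"
    unfolding total_mass_def using density_continuous density_pos
    by (intro sum_nonneg integral_nonneg integrable_continuous_interval) (auto simp: less_imp_le)
  \<comment> \<open>The other factor in \<open>bound\<close> is nonnegative, so a product above
    \<open>1\<close> forces a positive diameter; this permits the final division.\<close>
  have diam: "graph_diam G g > 0"
  proof (rule ccontr)
    assume "\<not> graph_diam G g > 0"
    then have "graph_diam G g * (lam 1 * total_mass G g \<rho>) \<le> 0"
      using mass first_eigenvalue(1)[OF assms(5)] by (intro mult_nonpos_nonneg) auto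
    then show False using bound by simp
  qed
  have "total_length G g > 0"
    unfolding total_length_def using arcs_nonempty len_pos by (intro sum_pos) auto
  then have "total_length G g * 1 < total_length G g * (graph_diam G g * (lam 1 * total_mass G g \<rho>))"
    using bound by (intro mult_strict_left_mono)
  then show ?thesis
    using diam by (simp add: normalized_eigenvalue_def field_simps)
qed

end
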